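(* Let $a>0$ and let $(f_n)_{n=1}^{\infty}$ be a sequence of monotone maps from the interval $[0,a]$ to itself such that $f_n(0)=0$ for every $n$. Assume also that this sequence is either pinched or equiconcave. For $x_0,y_0\in[0,a]$ define inductively $x_n=f_n(x_{n-1})$ and $y_n=f_n(y_{n-1})$ for $n\ge 1$. Then for every $x_0,y_0\in(0,a]$ we have $\lim_{n\to\infty}|x_n-y_n|=0$.
   Context: For $\alpha\ge 0$, a continuous real-valued function $f$ on a closed interval is $\alpha$-concave if the function $x\mapsto f(x)+\alpha x^2$ is concave. A sequence $(f_n)_{n=1}^\infty$ of maps from $[0,a]$ to itself with $f_n(0)=0$ for all $n$ is pinched if there exists $n$ such that $f_n$ is identically zero; it is equiconcave if there exists a constant $\beta>0$ such that each $f_n$ is $\beta\gamma_n$-concave, where $\gamma_n=\sup_{[0,a]} f_n$. *)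

theory Defs
  imports "HOL-Analysis.Analysis"
begin

definition alpha_concave_on :: "real \<Rightarrow> real \<Rightarrow> real \<Rightarrow> (real \<Rightarrow> real) \<Rightarrow> bool" where
  "alpha_concave_on l u \<alpha> f \<longleftrightarrow>
     0 \<le> \<alpha> \<and> continuous_on {l..u} f \<and> concave_on {l..u} (\<lambda>x. f x + \<alpha> * x\<^sup>2)"

(* A sequence (f_1, f_2, ...) of self-maps of [0,a] is represented by a total function
   nat => real => real. The index 0 and the values outside {0..a} are never used. *)

definition pinched :: "real \<Rightarrow> (nat \<Rightarrow> real \<Rightarrow> real) \<Rightarrow> bool" where
  "pinched a f \<longleftrightarrow> (\<exists>n\<ge>1. \<forall>x\<in>{0..a}. f n x = 0)"

definition equiconcave :: "real \<Rightarrow> (nat \<Rightarrow> real \<Rightarrow> real) \<Rightarrow> bool" where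
  "equiconcave a f \<longleftrightarrow>
     (\<exists>\<beta>>0. \<forall>n\<ge>1. alpha_concave_on 0 a (\<beta> * (SUP x\<in>{0..a}. f n x)) (f n))"

primrec orbit :: "(nat \<Rightarrow> real \<Rightarrow> real) \<Rightarrow> real \<Rightarrow> nat \<Rightarrow> real" where
  "orbit f x\<^sub>0 0 = x\<^sub>0"
| "orbit f x\<^sub>0 (Suc n) = f (Suc n) (orbit f x\<^sub>0 n)"

end

(* For y \<le> x put t = y / x. Concavity of f_n(x) + \<beta> \<gamma>_n x^2 between 0 and x, together with f_n(x) \<le> \<gamma>_n,
   gives f_n(y) / f_n(x) \<ge> t + \<beta> t (1 - t) x^2. Hence the defects s_n = 1 - y_n / x_n of two positive
   orbits decrease and satisfy s_n - s_(n+1) \<ge> c s_n x_n^2 with c > 0. So s_n x_n^2 tends to 0, and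
   (x_n - y_n)^2 = s_n^2 x_n^2 \<le> s_n x_n^2. *)

theory Submission
  imports Defs
begin

text \<open>The chord from 0 to \<open>x\<close> lies below the graph of the concave function, and
  its end at 0 contributes nothing. The quadratic terms at \<open>x\<close> and \<open>t * x\<close>
  leave \<open>t * x^2 - (t * x)^2 = t * (1 - t) * x^2\<close>, the gain over the chord of
  \<open>f\<close>.\<close>

lemma alpha_concave_on_scale_ge:
  assumes "alpha_concave_on 0 u \<alpha> f" and "f 0 = 0" and "x \<in> {0..u}" and "0 \<le> t" and "t \<le> 1"
  shows "t * f x + \<alpha> * t * (1 - t) * x\<^sup>2 \<le> f (t * x)"
proof -
  have "concave_on {0..u} (\<lambda>x. f x + \<alpha> * x\<^sup>2)"
    using assms(1) by (simp add: alpha_concave_on_def)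
  from concave_onD[OF this, of t 0 x] assms
  have "t * (f x + \<alpha> * x\<^sup>2) \<le> f (t * x) + \<alpha> * (t * x)\<^sup>2"
    by simp
  then show ?thesis
    by (simp add: algebra_simps power2_eq_square)
qed

text \<open>The concavity constant is proportional to the supremum of \<open>f\<close>, which is at
  least \<open>f x\<close>. Dividing by \<open>f x\<close> therefore leaves a gain in terms of
  \<beta>, \<open>x\<close> and \<open>y\<close> alone, uniform over all maps of the
  sequence.\<close>

lemma concave_ratio_ge:
  fixes a \<beta> x y :: real
  assumes conc: "alpha_concave_on 0 a (\<beta> * (SUP x\<in>{0..a}. f x)) f"
    and maps: "f \<in> {0..a} \<rightarrow> {0..a}" and "f 0 = 0" and "\<beta> > 0"
    and "0 < y" and "y \<le> x" and "x \<le> a" and "0 < f x"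
  shows "\<beta> * (y / x) * (1 - y / x) * x\<^sup>2 \<le> f y / f x - y / x"
proof -
  define t where "t = y / x"
  have t: "0 \<le> t" "t \<le> 1" "t * x = y"
    using assms by (auto simp: t_def)
  \<comment> \<open>The values of \<open>f\<close> are bounded by \<open>a\<close>, so the
    real-valued \<open>SUP\<close> is a genuine upper bound.\<close>
  have "f x \<le> (SUP x\<in>{0..a}. f x)"
    using assms by (intro cSUP_upper bdd_aboveI[where M = a]) auto
  then have "\<beta> * t * (1 - t) * x\<^sup>2 * f x \<le> \<beta> * t * (1 - t) * x\<^sup>2 * (SUP x\<in>{0..a}. f x)"
    using t \<open>\<beta> > 0\<close> by (intro mult_left_mono) auto
  also have "\<dots> \<le> f y - t * f x"
    using alpha_concave_on_scale_ge[OF conc \<open>f 0 = 0\<close>, of x t] t assms(5-7)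
    by (simp add: algebra_simps)
  finally have "\<beta> * t * (1 - t) * x\<^sup>2 \<le> (f y - t * f x) / f x"
    using \<open>0 < f x\<close> by (simp add: pos_le_divide_eq)
  also have "\<dots> = f y / f x - t"
    using \<open>0 < f x\<close> by (simp add: diff_divide_distrib)
  finally show ?thesis
    by (simp add: t_def)
qed

lemma orbit_in_interval:
  assumes "\<And>n. n \<ge> 1 \<Longrightarrow> f n \<in> {0..a} \<rightarrow> {0..a}" and "x \<in> {0..a}"
  shows "orbit f x n \<in> {0..a}"
proof (induction n)
  case (Suc n)
  then show ?case using assms(1)[of "Suc n"] by (auto simp: Pi_iff)
qed (use assms in simp)

lemma orbit_mono:
  assumes "\<And>n. n \<ge> 1 \<Longrightarrow> f n \<in> {0..a} \<rightarrow> {0..a}" and "\<And>n. n \<ge> 1 \<Longrightarrow> mono_on {0..a} (f n)"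
    and "x \<in> {0..a}" and "y \<in> {0..a}" and "y \<le> x"
  shows "orbit f y n \<le> orbit f x n"
proof (induction n)
  case (Suc n)
  then show ?case
    using assms orbit_in_interval[of f a] by (auto intro!: mono_onD[OF assms(2)])
qed (use assms in simp)

lemma orbit_eq_zero:
  assumes "\<And>n. n \<ge> 1 \<Longrightarrow> f n 0 = 0" and "orbit f x N = 0" and "N \<le> n"
  shows "orbit f x n = 0"
  using assms(3) by (induction n rule: dec_induct) (use assms in auto)

text \<open>Monotone maps preserve the order of the starting points, so the ratio of the two orbits
  stays in [0, 1] as long as the larger one is positive.\<close>

lemma orbits_diff_tendsto_0_ordered:
  fixes a :: real and f :: "nat \<Rightarrow> real \<Rightarrow> real"
  assumes maps: "\<And>n. n \<ge> 1 \<Longrightarrow> f n \<in> {0..a} \<rightarrow> {0..a}"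
    and mono: "\<And>n. n \<ge> 1 \<Longrightarrow> mono_on {0..a} (f n)"
    and zero: "\<And>n. n \<ge> 1 \<Longrightarrow> f n 0 = 0"
    and cases: "pinched a f \<or> equiconcave a f"
    and init: "x \<in> {0<..a}" "y \<in> {0<..a}" "y \<le> x"
  shows "(\<lambda>n. orbit f x n - orbit f y n) \<longlonglongrightarrow> 0"
proof -
  define X where "X = orbit f x"
  define Y where "Y = orbit f y"
  have XY: "X n \<le> a" "0 \<le> Y n" "Y n \<le> X n" for n
    using orbit_in_interval[of f a] orbit_mono[of f a x y] maps mono init
    by (auto simp: X_def Y_def)
  have "(\<lambda>n. X n - Y n) \<longlonglongrightarrow> 0"
  \<comment> \<open>Once the upper orbit reaches 0, both orbits stay there. Otherwise division by
    \<open>X n\<close> is legitimate for every \<open>n\<close>.\<close>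
  proof (cases "\<exists>N. X N = 0")
    case True
    then obtain N where "X N = 0" ..
    moreover from this have "Y N = 0"
      using XY[of N] by simp
    ultimately have "X n - Y n = 0" if "N \<le> n" for n
      using orbit_eq_zero[of f _ N n] zero that by (simp add: X_def Y_def)
    then show ?thesis
      by (intro tendsto_eventually eventually_sequentiallyI)
  next
    case False
    then have X_pos: "0 < X n" for n
      using XY[of n] by (simp add: order_less_le)
    \<comment> \<open>A map that vanishes identically would send the upper orbit to 0, so only the
      equiconcave alternative remains.\<close>
    have "\<not> pinched a f"
    proof
      assume "pinched a f"
      then obtain m where "\<forall>x\<in>{0..a}. f (Suc m) x = 0"
        by (auto simp: pinched_def dest!: Suc_le_D)
      then have "X (Suc m) = 0"
        using XY[of m] by (simp add: X_def)
      with X_pos[of "Suc m"] show False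
        by simp
    qed
    with cases obtain \<beta> where "\<beta> > 0"
      and conc: "\<And>n. n \<ge> 1 \<Longrightarrow> alpha_concave_on 0 a (\<beta> * (SUP x\<in>{0..a}. f n x)) (f n)"
      by (auto simp: equiconcave_def)
    define r where "r n = Y n / X n" for n
    have step: "\<beta> * r n * (1 - r n) * (X n)\<^sup>2 \<le> r (Suc n) - r n" if "0 < Y n" for n
      using concave_ratio_ge[OF conc maps zero \<open>\<beta> > 0\<close> that, of "Suc n" "X n"]
        XY[of n] X_pos[of "Suc n"]
      by (simp add: r_def X_def Y_def)
    have r_le_1: "r n \<le> 1" for n
      using XY[of n] X_pos[of n] by (simp add: r_def)
    have r0: "0 < r 0"
      using init by (simp add: r_def X_def Y_def)
    \<comment> \<open>The estimate \<open>step\<close> needs \<open>0 < Y n\<close>. The induction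
      supplies it: the bound for \<open>n\<close> keeps \<open>r n\<close> positive, and
      \<open>step\<close> then carries the bound to \<open>Suc n\<close>.\<close>
    have r_ge: "r 0 \<le> r n" for n
    proof (induction n)
      case (Suc n)
      then have "0 < r n"
        using r0 by simp
      then have "0 < Y n" and "0 \<le> \<beta> * r n * (1 - r n) * (X n)\<^sup>2"
        using X_pos[of n] r_le_1[of n] \<open>\<beta> > 0\<close> by (simp_all add: r_def zero_less_divide_iff)
      with Suc step[of n] show ?case by linarith
    qed simp
    \<comment> \<open>Replacing the factor \<open>r n\<close> in \<open>step\<close> by its lower
      bound \<open>r 0\<close> gives a constant independent of \<open>n\<close>.\<close>
    define c where "c = \<beta> * r 0"
    have "0 < c"
      using r0 \<open>\<beta> > 0\<close> by (simp add: c_def)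
    have decr: "c * ((1 - r n) * (X n)\<^sup>2) \<le> r (Suc n) - r n" for n
    proof -
      have "0 < r n"
        using r0 r_ge[of n] by linarith
      then have "0 < Y n"
        using X_pos[of n] by (simp add: r_def zero_less_divide_iff)
      have "c * ((1 - r n) * (X n)\<^sup>2) \<le> \<beta> * r n * ((1 - r n) * (X n)\<^sup>2)"
        unfolding c_def using r_ge[of n] r_le_1[of n] \<open>\<beta> > 0\<close>
        by (intro mult_right_mono mult_left_mono mult_nonneg_nonneg) auto
      with step[OF \<open>0 < Y n\<close>] show ?thesis
        by (simp add: mult.assoc)
    qed
    have incseq: "incseq r"
    proof (rule incseq_SucI)
      fix n
      have "0 \<le> c * ((1 - r n) * (X n)\<^sup>2)"
        using \<open>0 < c\<close> r_le_1[of n] by simp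
      with decr[of n] show "r n \<le> r (Suc n)" by linarith
    qed
    \<comment> \<open>A bounded increasing sequence converges, so its increments tend to 0.\<close>
    then obtain L where "r \<longlonglongrightarrow> L"
      using incseq_convergent[of r 1] r_le_1 by metis
    then have "(\<lambda>n. (r (Suc n) - r n) / c) \<longlonglongrightarrow> (L - L) / c"
      using \<open>0 < c\<close> by (intro tendsto_intros LIMSEQ_Suc) auto
    then have lim: "(\<lambda>n. (r (Suc n) - r n) / c) \<longlonglongrightarrow> 0"
      by simp
    have upper: "(X n - Y n)\<^sup>2 \<le> (r (Suc n) - r n) / c" for n
    proof -
      have "X n - Y n = (1 - r n) * X n"
        using X_pos[of n] by (simp add: r_def field_simps)
      then have "(X n - Y n)\<^sup>2 = (1 - r n) * ((1 - r n) * (X n)\<^sup>2)"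
        by (simp add: power2_eq_square)
      \<comment> \<open>One of the two factors \<open>1 - r n\<close> is bounded by 1; what is left
        is the quantity that \<open>decr\<close> controls.\<close>
      also have "\<dots> \<le> 1 * ((1 - r n) * (X n)\<^sup>2)"
        using r0 r_ge[of n] r_le_1[of n] by (intro mult_right_mono) auto
      also have "\<dots> \<le> (r (Suc n) - r n) / c"
        using decr[of n] \<open>0 < c\<close> by (simp add: pos_le_divide_eq mult.commute)
      finally show ?thesis .
    qed
    have "(\<lambda>n. (X n - Y n)\<^sup>2) \<longlonglongrightarrow> 0"
      by (rule tendsto_sandwich[OF _ _ tendsto_const lim]) (use upper in auto)
    then show ?thesis
      by (simp add: power_tendsto_0_iff)
  qed
  then show ?thesis
    by (simp add: X_def Y_def)
qed

theorem theorem5p2: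
  fixes a :: real and f :: "nat \<Rightarrow> real \<Rightarrow> real" and x\<^sub>0 y\<^sub>0 :: real
  assumes "a > 0"
    and "\<And>n. n \<ge> 1 \<Longrightarrow> f n \<in> {0..a} \<rightarrow> {0..a}"
    and "\<And>n. n \<ge> 1 \<Longrightarrow> mono_on {0..a} (f n)"
    and "\<And>n. n \<ge> 1 \<Longrightarrow> f n 0 = 0"
    and "pinched a f \<or> equiconcave a f"
    and "x\<^sub>0 \<in> {0<..a}" and "y\<^sub>0 \<in> {0<..a}"
  shows "(\<lambda>n. \<bar>orbit f x\<^sub>0 n - orbit f y\<^sub>0 n\<bar>) \<longlonglongrightarrow> 0"
proof (cases "y\<^sub>0 \<le> x\<^sub>0")
  case True
  from orbits_diff_tendsto_0_ordered[OF assms(2-7) this] show ?thesis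
    by (rule tendsto_rabs_zero)
next
  case False
  \<comment> \<open>The absolute value is symmetric, so the two orbits may exchange roles.\<close>
  then have "x\<^sub>0 \<le> y\<^sub>0" by simp
  from tendsto_rabs_zero[OF orbits_diff_tendsto_0_ordered[OF assms(2-5) assms(7,6) this]]
  show ?thesis
    by (simp add: abs_minus_commute)
qed

end
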